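(* Let $X$ be a finite set with $n$ elements and let $\mathfrak{X}=(X,\{R_0,R_1,R_2\})$ be a symmetric $2$-class association scheme with adjacency matrices $A_0=I,A_1,A_2$ and first eigenmatrix $$P=\begin{pmatrix}1&k_1&k_2\\ 1&r&-(r+1)\\ 1&s&-(s+1)\end{pmatrix},$$ where $r,s\in\mathbb{R}$, $r\geq 0$, $s\leq -1$, and $r+s\geq -1$. Let $\Gamma$ be the strongly regular graph $(X,R_1)$. Let $w_0,w_1,w_2$ be complex numbers of absolute value $1$ with $w_1\neq w_2$, let $W_1=w_0A_0+w_1A_1+w_2A_2$, and let $$W=\begin{pmatrix}1&\boldsymbol{e}\\ \boldsymbol{e}^\top & W_1\end{pmatrix},$$ where $\boldsymbol{e}$ is the all-ones row vector of length $n$. If $W$ is a complex Hadamard matrix, then one of the following holds: (i) $\Gamma$ is a conference graph on $(2r+1)^2$ vertices, and either (a) $(w_0,w_1,w_2)=(-1,\pm i,\mp i)$, or (b) $(w_0,w_1,w_2)=\left(1,\frac{-1\pm i\sqrt{4r^2(r+1)^2-1}}{2r(r+1)},\frac{-1\mp i\sqrt{4r^2(r+1)^2-1}}{2r(r+1)}\right)$; (ii) $\Gamma$ has eigenvalues $(k_1,r,s)=(2r^2,r,-r)$ and $(w_0,w_1,w_2)=(1,-1,1)$. Conversely, if (i) or (ii) holds, then $W$ is a complex Hadamard matrix.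
   Context: A complex Hadamard matrix of order $m$ is an $m\times m$ matrix $H$ all of whose entries have absolute value $1$ and with $H\overline{H}^\top=mI$. The first eigenmatrix $P=(P_{i,j})$ is defined by $A_j=\sum_{i=0}^2P_{i,j}E_i$ ($j=0,1,2$), where $E_0=\frac1nJ,E_1,E_2$ are the primitive idempotents of the Bose--Mesner algebra spanned by $A_0,A_1,A_2$; thus $k_1,k_2$ are the valencies and $r,s$ are the nontrivial eigenvalues of $\Gamma$. A conference graph is a strongly regular graph with $k_1=2r(r+1)$ and $r+s=-1$ (equivalently, whose two nontrivial eigenvalues have equal multiplicities). *)

theory Defs
  imports "HOL-Analysis.Analysis"
begin

text \<open>
  The point set of a scheme is the whole of a finite type, and square matrices indexed by the
  points are elements of \<^typ>\<open>complex^'a^'a\<close>. A graph is given by its adjacency relation.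
\<close>

definition adjacency_matrix :: "('a::finite) rel \<Rightarrow> complex^'a^'a" where
  "adjacency_matrix G = (\<chi> x y. if (x, y) \<in> G then 1 else 0)"

definition matrix_scale :: "complex \<Rightarrow> complex^'n^'m \<Rightarrow> complex^'n^'m" where
  "matrix_scale c M = (\<chi> x y. c * M $ x $ y)"

definition complex_hadamard :: "complex^'m^'m \<Rightarrow> bool" where
  "complex_hadamard H \<longleftrightarrow>
     (\<forall>x y. cmod (H $ x $ y) = 1) \<and>
     H ** transpose (\<chi> x y. cnj (H $ x $ y)) = mat (of_nat CARD('m))"

text \<open>The index \<^const>\<open>None\<close> is that of the additional first row and column.\<close>

definition bordered :: "complex^'a^'a \<Rightarrow> complex^('a option)^('a option)" where
  "bordered M = (\<chi> x y. case (x, y) of (Some a, Some b) \<Rightarrow> M $ a $ b | _ \<Rightarrow> 1)"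

definition symmetric_association_scheme :: "nat \<Rightarrow> (nat \<Rightarrow> ('a::finite) rel) \<Rightarrow> bool" where
  "symmetric_association_scheme d R \<longleftrightarrow>
     R 0 = Id \<and>
     (\<forall>i\<le>d. R i \<noteq> {}) \<and>
     (\<forall>i\<le>d. \<forall>j\<le>d. i \<noteq> j \<longrightarrow> R i \<inter> R j = {}) \<and>
     (\<Union>i\<le>d. R i) = UNIV \<and>
     (\<forall>i\<le>d. sym (R i)) \<and>
     (\<forall>i\<le>d. \<forall>j\<le>d. \<forall>k\<le>d. \<exists>p. \<forall>(x, y) \<in> R k.
        card {z. (x, z) \<in> R i \<and> (z, y) \<in> R j} = p)"

definition bose_mesner :: "nat \<Rightarrow> (nat \<Rightarrow> ('a::finite) rel) \<Rightarrow> (complex^'a^'a) set" where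
  "bose_mesner d R = range (\<lambda>c. \<Sum>j\<le>d. matrix_scale (c j) (adjacency_matrix (R j)))"

definition primitive_idempotents :: "(complex^'a^'a) set \<Rightarrow> (complex^'a^'a) set" where
  "primitive_idempotents \<A> =
     {E \<in> \<A>. E \<noteq> 0 \<and> E ** E = E \<and>
        (\<forall>F\<in>\<A>. \<forall>G\<in>\<A>. F ** F = F \<and> G ** G = G \<and> F ** G = 0 \<and> G ** F = 0 \<and> E = F + G
           \<longrightarrow> F = 0 \<or> G = 0)}"

text \<open>
  The eigenmatrix depends on the order of the primitive idempotents other than \<open>J/n\<close>; the
  predicate holds of the eigenmatrix for each such ordering.
\<close>

definition first_eigenmatrix ::
  "nat \<Rightarrow> (nat \<Rightarrow> ('a::finite) rel) \<Rightarrow> (nat \<Rightarrow> nat \<Rightarrow> complex) \<Rightarrow> bool" where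
  "first_eigenmatrix d R P \<longleftrightarrow>
     (\<exists>E. bij_betw E {..d} (primitive_idempotents (bose_mesner d R)) \<and>
          E 0 = (\<chi> x y. 1 / of_nat CARD('a)) \<and>
          (\<forall>j\<le>d. adjacency_matrix (R j) = (\<Sum>i\<le>d. matrix_scale (P i j) (E i))))"

definition strongly_regular :: "('a::finite) rel \<Rightarrow> nat \<Rightarrow> nat \<Rightarrow> nat \<Rightarrow> bool" where
  "strongly_regular G k l m \<longleftrightarrow>
     sym G \<and> irrefl G \<and> G \<noteq> {} \<and> G \<union> Id \<noteq> UNIV \<and>
     (\<forall>x. card {y. (x, y) \<in> G} = k) \<and>
     (\<forall>x y. (x, y) \<in> G \<longrightarrow> card {z. (x, z) \<in> G \<and> (z, y) \<in> G} = l) \<and>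
     (\<forall>x y. x \<noteq> y \<and> (x, y) \<notin> G \<longrightarrow> card {z. (x, z) \<in> G \<and> (z, y) \<in> G} = m)"

text \<open>
  For a regular graph, the nontrivial eigenvalues are those with an eigenvector orthogonal to the
  all-ones vector. For a disconnected graph the valency is one of them.
\<close>

definition nontrivial_eigenvalues :: "('a::finite) rel \<Rightarrow> complex set" where
  "nontrivial_eigenvalues G =
     {\<theta>. \<exists>v. v \<noteq> 0 \<and> (\<Sum>x\<in>UNIV. v $ x) = 0 \<and> adjacency_matrix G *v v = \<theta> *s v}"

text \<open>
  As \<open>r + s = -1\<close>, the value \<open>2 * r * (r + 1)\<close> is unchanged when \<open>r\<close> and \<open>s\<close> are swapped.
\<close>

definition conference_graph :: "('a::finite) rel \<Rightarrow> bool" where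
  "conference_graph G \<longleftrightarrow>
     (\<exists>k l m. \<exists>r s :: real. strongly_regular G k l m \<and>
        nontrivial_eigenvalues G = {complex_of_real r, complex_of_real s} \<and>
        real k = 2 * r * (r + 1) \<and> r + s = -1)"

end

theory Submission
  imports Defs
begin

text \<open>
  In the Bose--Mesner algebra \<open>W\<^sub>1 = \<theta>\<^sub>0 E\<^sub>0 + \<theta>\<^sub>1 E\<^sub>1 + \<theta>\<^sub>2 E\<^sub>2\<close>, so \<open>W\<close> is Hadamard iff
  \<open>\<theta>\<^sub>0 = -1\<close> and \<open>|\<theta>\<^sub>1|\<^sup>2 = |\<theta>\<^sub>2|\<^sup>2 = n + 1\<close>. Put \<open>a = Re (w\<^sub>0 cnj w\<^sub>1)\<close>, \<open>b = Re (w\<^sub>0 cnj w\<^sub>2)\<close>,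
  \<open>g = 1 - Re (w\<^sub>1 cnj w\<^sub>2) \<in> (0, 2]\<close>, \<open>d = r + s + 1\<close>, \<open>q = -rs\<close> and \<open>N = n - 1\<close>. The last two equations
  say \<open>b = a + g d\<close> and \<open>2 g q = N + 2 b\<close>, while the graph satisfies \<open>N q = k\<^sub>1 (k\<^sub>2 + d)\<close> with \<open>d\<close>,
  \<open>q\<close> integers. If \<open>d \<ge> 1\<close>, then \<open>a \<ge> -1\<close> and \<open>g \<le> 2\<close> give \<open>4 q \<ge> N - 2 + 4 d\<close>, and the
  arithmetic-geometric mean bound \<open>4 N q \<le> (N + d)\<^sup>2\<close> leaves only \<open>d = 1\<close>, \<open>4 q = N + 2\<close> and
  \<open>k\<^sub>1 - k\<^sub>2 \<in> {0, 2}\<close>; the handshake lemma excludes \<open>k\<^sub>1 = k\<^sub>2\<close>, and the other case is (ii). If \<open>d = 0\<close>,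
  then \<open>a = b\<close>, the vanishing Gram determinant of \<open>w\<^sub>0, w\<^sub>1, w\<^sub>2\<close> in the plane gives \<open>g = 2 - 2 a\<^sup>2\<close>, and the
  resulting quadratic equation for \<open>a\<close> has, \<open>q\<close> being an integer, real roots only for
  \<open>k\<^sub>1 = k\<^sub>2\<close>; its roots \<open>0\<close> and
  \<open>-1/k\<^sub>1\<close> are (a) and (b) of (i).
\<close>

section \<open>Spectral decomposition of the Bose--Mesner algebra\<close>

lemma matrix_scale_nth [simp]: "matrix_scale c M $ x $ y = c * M $ x $ y"
  by (simp add: matrix_scale_def)

lemma adjacency_matrix_nth [simp]: "adjacency_matrix G $ x $ y = (if (x, y) \<in> G then 1 else 0)"
  by (simp add: adjacency_matrix_def)

section \<open>Entrywise description and closure properties of the Bose--Mesner algebra\<close>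

lemma symmetric_association_schemeD:
  assumes "symmetric_association_scheme d R"
  shows "R 0 = Id" "i \<le> d \<Longrightarrow> R i \<noteq> {}" "i \<le> d \<Longrightarrow> j \<le> d \<Longrightarrow> i \<noteq> j \<Longrightarrow> R i \<inter> R j = {}"
    "(\<Union>i\<le>d. R i) = UNIV" "i \<le> d \<Longrightarrow> sym (R i)"
    "i \<le> d \<Longrightarrow> j \<le> d \<Longrightarrow> k \<le> d \<Longrightarrow>
      \<exists>p. \<forall>(x, y)\<in>R k. card {z. (x, z) \<in> R i \<and> (z, y) \<in> R j} = p"
  using assms unfolding symmetric_association_scheme_def by simp_all

lemma scheme_relation_exists:
  assumes "symmetric_association_scheme d R"
  obtains i where "i \<le> d" "(x, y) \<in> R i"
  using symmetric_association_schemeD(4)[OF assms] by blast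

lemma scheme_relation_unique:
  assumes "symmetric_association_scheme d R" "i \<le> d" "j \<le> d" "(x, y) \<in> R i"
  shows "(x, y) \<in> R j \<longleftrightarrow> j = i"
  using symmetric_association_schemeD(3)[OF assms(1-3)] assms(4) by blast

lemma scheme_combination_nth:
  assumes "symmetric_association_scheme d R" "i \<le> d" "(x, y) \<in> R i"
  shows "(\<Sum>j\<le>d. matrix_scale (c j) (adjacency_matrix (R j))) $ x $ y = c i"
proof -
  have "(\<Sum>j\<le>d. matrix_scale (c j) (adjacency_matrix (R j))) $ x $ y = (\<Sum>j\<le>d. c j * (if j = i then 1 else 0))"
    by (auto simp: scheme_relation_unique[OF assms(1,2) _ assms(3)] intro!: sum.cong)
  also have "\<dots> = (\<Sum>j\<le>d. if j = i then c j else 0)"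
    by (intro sum.cong) auto
  finally show ?thesis using assms(2) by simp
qed

text \<open>The relations partition the pairs of points, so the span of the adjacency matrices
  consists of the matrices that are constant on each relation. This turns membership into an
  entrywise check.\<close>

lemma bose_mesner_iff:
  assumes "symmetric_association_scheme d R"
  shows "M \<in> bose_mesner d R \<longleftrightarrow> (\<exists>c. \<forall>j\<le>d. \<forall>(x, y)\<in>R j. M $ x $ y = c j)"
proof
  assume "M \<in> bose_mesner d R"
  then obtain c where "M = (\<Sum>j\<le>d. matrix_scale (c j) (adjacency_matrix (R j)))"
    unfolding bose_mesner_def by (rule rangeE)
  then have "M $ x $ y = c j" if "j \<le> d" "(x, y) \<in> R j" for j x y
    using scheme_combination_nth[OF assms that] by simp
  then show "\<exists>c. \<forall>j\<le>d. \<forall>(x, y)\<in>R j. M $ x $ y = c j"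
    by (intro exI[of _ c]) auto
next
  assume "\<exists>c. \<forall>j\<le>d. \<forall>(x, y)\<in>R j. M $ x $ y = c j"
  then obtain c where c: "\<And>j x y. j \<le> d \<Longrightarrow> (x, y) \<in> R j \<Longrightarrow> M $ x $ y = c j" by blast
  have "M = (\<Sum>j\<le>d. matrix_scale (c j) (adjacency_matrix (R j)))"
  proof -
    have "M $ x $ y = (\<Sum>j\<le>d. matrix_scale (c j) (adjacency_matrix (R j))) $ x $ y" for x y
    proof -
      obtain i where "i \<le> d" "(x, y) \<in> R i" by (rule scheme_relation_exists[OF assms])
      then show ?thesis by (simp only: c scheme_combination_nth[OF assms])
    qed
    then show ?thesis by (simp add: vec_eq_iff)
  qed
  then show "M \<in> bose_mesner d R"
    using rangeI[of "\<lambda>c. \<Sum>j\<le>d. matrix_scale (c j) (adjacency_matrix (R j))" c]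
    unfolding bose_mesner_def by simp
qed

lemma bose_mesner_adjacency_matrix:
  assumes "symmetric_association_scheme d R" "j \<le> d"
  shows "adjacency_matrix (R j) \<in> bose_mesner d R"
  unfolding bose_mesner_iff[OF assms(1)]
  by (rule exI[of _ "\<lambda>i. if i = j then 1 else 0"])
    (auto simp: scheme_relation_unique[OF assms(1) _ assms(2)])

lemma bose_mesner_diff:
  assumes "symmetric_association_scheme d R" "M \<in> bose_mesner d R" "N \<in> bose_mesner d R"
  shows "M - N \<in> bose_mesner d R"
proof -
  obtain c c' where "\<And>j x y. j \<le> d \<Longrightarrow> (x, y) \<in> R j \<Longrightarrow> M $ x $ y = c j"
      "\<And>j x y. j \<le> d \<Longrightarrow> (x, y) \<in> R j \<Longrightarrow> N $ x $ y = c' j"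
    using assms(2,3) unfolding bose_mesner_iff[OF assms(1)] by blast
  then show ?thesis
    unfolding bose_mesner_iff[OF assms(1)] by (intro exI[of _ "\<lambda>j. c j - c' j"]) auto
qed

lemma bose_mesner_transpose:
  assumes "symmetric_association_scheme d R" "M \<in> bose_mesner d R"
  shows "transpose M = M"
proof -
  obtain c where c: "\<And>j x y. j \<le> d \<Longrightarrow> (x, y) \<in> R j \<Longrightarrow> M $ x $ y = c j"
    using assms(2) unfolding bose_mesner_iff[OF assms(1)] by blast
  have "M $ y $ x = M $ x $ y" for x y
  proof -
    obtain i where i: "i \<le> d" "(x, y) \<in> R i" by (rule scheme_relation_exists[OF assms(1)])
    then have "(y, x) \<in> R i" using symmetric_association_schemeD(5)[OF assms(1)] by (blast dest: symD)
    then show ?thesis using i by (simp only: c)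
  qed
  then show ?thesis by (simp add: transpose_def vec_eq_iff)
qed

text \<open>The intersection numbers are the structure constants: the entry of the product at a pair
  in \<open>R k\<close> counts the intermediate points, weighted by the coefficients of both
  factors, and depends on \<open>k\<close> only.\<close>

lemma bose_mesner_mult:
  assumes sch: "symmetric_association_scheme d R" and "M \<in> bose_mesner d R" "N \<in> bose_mesner d R"
  shows "M ** N \<in> bose_mesner d R"
proof -
  obtain c c' where c: "M = (\<Sum>j\<le>d. matrix_scale (c j) (adjacency_matrix (R j)))"
      and c': "N = (\<Sum>j\<le>d. matrix_scale (c' j) (adjacency_matrix (R j)))"
    using assms(2,3) unfolding bose_mesner_def by (elim rangeE)
  define p where "p i j k = (SOME p. \<forall>(x, y)\<in>R k. card {z. (x, z) \<in> R i \<and> (z, y) \<in> R j} = p)" for i j k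
  from someI_ex[OF symmetric_association_schemeD(6)[OF sch]] have p: "card {z. (x, z) \<in> R i \<and> (z, y) \<in> R j} = p i j k"
    if "i \<le> d" "j \<le> d" "k \<le> d" "(x, y) \<in> R k" for i j k x y
    using that unfolding p_def by fast
  have "(M ** N) $ x $ y = (\<Sum>i\<le>d. \<Sum>j\<le>d. c i * c' j * p i j k)" if "k \<le> d" "(x, y) \<in> R k" for k x y
  proof -
    have "(M ** N) $ x $ y = (\<Sum>z\<in>UNIV. (\<Sum>i\<le>d. c i * of_bool ((x, z) \<in> R i)) *
        (\<Sum>j\<le>d. c' j * of_bool ((z, y) \<in> R j)))"
      unfolding c c' by (simp add: matrix_matrix_mult_def of_bool_def)
    also have "\<dots> = (\<Sum>z\<in>UNIV. \<Sum>i\<le>d. \<Sum>j\<le>d. c i * c' j * of_bool ((x, z) \<in> R i \<and> (z, y) \<in> R j))"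
      unfolding sum_product by (simp only: of_bool_conj mult_ac)
    also have "\<dots> = (\<Sum>i\<le>d. \<Sum>z\<in>UNIV. \<Sum>j\<le>d. c i * c' j * of_bool ((x, z) \<in> R i \<and> (z, y) \<in> R j))"
      by (rule sum.swap)
    also have "\<dots> = (\<Sum>i\<le>d. \<Sum>j\<le>d. \<Sum>z\<in>UNIV. c i * c' j * of_bool ((x, z) \<in> R i \<and> (z, y) \<in> R j))"
      by (intro sum.cong refl sum.swap)
    also have "\<dots> = (\<Sum>i\<le>d. \<Sum>j\<le>d. c i * c' j * p i j k)"
    proof (intro sum.cong refl)
      fix i j assume "i \<in> {..d}" "j \<in> {..d}"
      then have "(\<Sum>z\<in>UNIV. of_bool ((x, z) \<in> R i \<and> (z, y) \<in> R j)) = (of_nat (p i j k) :: complex)"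
        using p[OF _ _ that, of i j] by (simp add: sum_of_bool_eq)
      then show "(\<Sum>z\<in>UNIV. c i * c' j * of_bool ((x, z) \<in> R i \<and> (z, y) \<in> R j)) = c i * c' j * p i j k"
        by (simp only: flip: sum_distrib_left)
    qed
    finally show ?thesis .
  qed
  then show ?thesis
    unfolding bose_mesner_iff[OF sch]
    by (intro exI[of _ "\<lambda>k. \<Sum>i\<le>d. \<Sum>j\<le>d. c i * c' j * p i j k"]) auto
qed

text \<open>All members are symmetric, the product included, so \<open>M ** N\<close> equals its
  transpose \<open>N ** M\<close>.\<close>

lemma bose_mesner_commute:
  assumes "symmetric_association_scheme d R" "M \<in> bose_mesner d R" "N \<in> bose_mesner d R"
  shows "M ** N = N ** M"
  by (metis assms bose_mesner_mult bose_mesner_transpose matrix_transpose_mul)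

section \<open>Orthogonality of the primitive idempotents\<close>

lemma matrix_diff_ldistrib: "A ** (B - C) = A ** B - A ** (C :: complex^'n^'m)"
  by (simp add: matrix_matrix_mult_def vec_eq_iff sum_subtractf algebra_simps)

lemma matrix_diff_rdistrib: "(B - C) ** A = B ** A - C ** (A :: complex^'n^'m)"
  by (simp add: matrix_matrix_mult_def vec_eq_iff sum_subtractf algebra_simps)

text \<open>By commutativity \<open>A = A ** B + (A - A ** B)\<close> splits \<open>A\<close> into
  orthogonal idempotents of the algebra, so primitivity makes one summand vanish. If
  \<open>E ** F\<close> were nonzero, it would equal both \<open>E\<close> and
  \<open>F\<close>.\<close>

lemma primitive_idempotents_orthogonal:
  assumes sch: "symmetric_association_scheme d R"
    and E: "E \<in> primitive_idempotents (bose_mesner d R)"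
    and F: "F \<in> primitive_idempotents (bose_mesner d R)" and "E \<noteq> F"
  shows "E ** F = 0"
proof -
  have absorb: "A ** B = 0 \<or> A ** B = A"
    if A: "A \<in> primitive_idempotents (bose_mesner d R)"
      and B: "B \<in> primitive_idempotents (bose_mesner d R)" for A B
  proof -
    have AB: "A \<in> bose_mesner d R" "B \<in> bose_mesner d R" "A ** A = A" "B ** B = B"
      using A B by (auto simp: primitive_idempotents_def)
    have com: "B ** A = A ** B" using bose_mesner_commute[OF sch] AB by blast
    have in_BM: "A ** B \<in> bose_mesner d R" "A - A ** B \<in> bose_mesner d R"
      using AB bose_mesner_mult[OF sch] bose_mesner_diff[OF sch] by auto
    have AAB: "A ** (A ** B) = A ** B" by (simp add: matrix_mul_assoc AB)
    have ABA: "(A ** B) ** A = A ** B" by (metis com matrix_mul_assoc AB(3))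
    have ABAB: "(A ** B) ** (A ** B) = A ** B" by (metis ABA matrix_mul_assoc AB(4))
    have "(A - A ** B) ** (A - A ** B) = A - A ** B"
      "(A ** B) ** (A - A ** B) = 0" "(A - A ** B) ** (A ** B) = 0"
      by (simp_all add: matrix_diff_ldistrib matrix_diff_rdistrib AB AAB ABA ABAB)
    then have "A ** B = 0 \<or> A - A ** B = 0"
      using A in_BM ABAB unfolding primitive_idempotents_def mem_Collect_eq by fastforce
    then show ?thesis by auto
  qed
  have "E \<in> bose_mesner d R" "F \<in> bose_mesner d R"
    using E F by (auto simp: primitive_idempotents_def)
  then have "F ** E = E ** F" using bose_mesner_commute[OF sch] by blast
  then show ?thesis using absorb[OF E F] absorb[OF F E] \<open>E \<noteq> F\<close> by auto
qed

section \<open>Bilinearity of the product and the Hadamard condition for bordered matrices\<close>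

lemma matrix_scale_matrix_mult: "matrix_scale c M ** N = matrix_scale c (M ** N)"
  by (simp add: vec_eq_iff matrix_matrix_mult_def sum_distrib_left mult.assoc)

lemma matrix_mult_matrix_scale: "M ** matrix_scale c N = matrix_scale c (M ** N)"
  by (simp add: vec_eq_iff matrix_matrix_mult_def sum_distrib_left mult_ac)

text \<open>Orthogonality of the border row to the others fixes the row sums of \<open>M\<close>.
  Between two other rows the border contributes 1 to each inner product, whence the all-ones matrix
  is subtracted.\<close>

lemma complex_hadamard_bordered_iff:
  fixes M :: "complex^'a^'a"
  shows "complex_hadamard (bordered M) \<longleftrightarrow>
    (\<forall>x y. cmod (M $ x $ y) = 1) \<and> (\<forall>x. (\<Sum>y\<in>UNIV. M $ x $ y) = -1) \<and>
    M ** transpose (\<chi> x y. cnj (M $ x $ y)) = mat (of_nat CARD('a) + 1) - (\<chi> x y. 1)"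
proof -
  have bordered: "bordered M $ None $ y = 1" "bordered M $ x $ None = 1"
    "bordered M $ Some a $ Some b = M $ a $ b" for x y a b
    by (simp_all add: bordered_def split: option.split)
  have sum_option: "(\<Sum>x\<in>UNIV. f x) = f None + (\<Sum>a\<in>UNIV. f (Some a))" for f :: "'a option \<Rightarrow> complex"
    by (simp add: UNIV_option_conv sum.reindex)
  have card: "CARD('a option) = CARD('a) + 1"
    by (simp add: card_UNIV_option)
  have row: "1 + c = 0 \<longleftrightarrow> c = -1" for c :: complex
    by (simp add: add_eq_0_iff)
  have cnj_row: "(\<Sum>y\<in>UNIV. cnj (M $ x $ y)) = -1 \<longleftrightarrow> (\<Sum>y\<in>UNIV. M $ x $ y) = -1" for x
    by (metis cnj_sum complex_cnj_cnj complex_cnj_minus complex_cnj_one)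
  have eq: "1 + c = t \<longleftrightarrow> c = t - 1" for c t :: complex by auto
  show ?thesis
    unfolding complex_hadamard_def vec_eq_iff split_option_all
    by (simp add: bordered card sum_option matrix_matrix_mult_def transpose_def mat_def
        cnj_row row eq) (auto simp: eq)
qed

lemma sum_matrix_mult: "(\<Sum>i\<in>I. f i :: complex^'n^'m) ** N = (\<Sum>i\<in>I. f i ** N)"
  unfolding vec_eq_iff matrix_matrix_mult_def by (simp add: sum_distrib_right sum.swap[of _ I])

lemma matrix_mult_sum: "N ** (\<Sum>i\<in>I. f i :: complex^'n^'m) = (\<Sum>i\<in>I. N ** f i)"
  unfolding vec_eq_iff matrix_matrix_mult_def by (simp add: sum_distrib_left sum.swap[of _ I])

text \<open>This collects what an eigenmatrix provides for computing: nonzero, mutually orthogonal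
  idempotents in the algebra, with column \<open>j\<close> of \<open>P\<close> listing the
  eigenvalues of the adjacency matrix of \<open>R j\<close> on their images.\<close>

locale scheme_spectrum =
  fixes d :: nat and R :: "nat \<Rightarrow> ('a::finite) rel" and P :: "nat \<Rightarrow> nat \<Rightarrow> real"
    and E :: "nat \<Rightarrow> complex^'a^'a"
  assumes scheme: "symmetric_association_scheme d R"
    and E_0: "E 0 = (\<chi> x y. 1 / of_nat CARD('a))"
    and E_nonzero: "i \<le> d \<Longrightarrow> E i \<noteq> 0"
    and E_in: "i \<le> d \<Longrightarrow> E i \<in> bose_mesner d R"
    and E_mult: "i \<le> d \<Longrightarrow> j \<le> d \<Longrightarrow> E i ** E j = (if i = j then E i else 0)"
    and adjacency_expansion:
      "j \<le> d \<Longrightarrow> adjacency_matrix (R j) = (\<Sum>i\<le>d. matrix_scale (of_real (P i j)) (E i))"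

lemma first_eigenmatrix_spectrum:
  assumes sch: "symmetric_association_scheme d R"
    and "first_eigenmatrix d R (\<lambda>i j. complex_of_real (P i j))"
  obtains E where "scheme_spectrum d R P E"
proof -
  obtain E where bij: "bij_betw E {..d} (primitive_idempotents (bose_mesner d R))"
    and E: "E 0 = (\<chi> x y. 1 / of_nat CARD('a))"
      "\<And>j. j \<le> d \<Longrightarrow> adjacency_matrix (R j) = (\<Sum>i\<le>d. matrix_scale (complex_of_real (P i j)) (E i))"
    using assms(2) unfolding first_eigenmatrix_def by blast
  have prim: "E i \<in> primitive_idempotents (bose_mesner d R)" if "i \<le> d" for i
    using bij that by (auto simp: bij_betw_def)
  have "E i ** E j = (if i = j then E i else 0)" if "i \<le> d" "j \<le> d" for i j
  proof (cases "i = j")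
    case True
    then show ?thesis using prim[OF that(1)] by (simp add: primitive_idempotents_def)
  next
    case False
    then have "E i \<noteq> E j" using bij that by (auto simp: bij_betw_def inj_on_def)
    then show ?thesis
      using primitive_idempotents_orthogonal[OF sch prim prim] that False by simp
  qed
  then have "scheme_spectrum d R P E"
    using sch E prim by unfold_locales (auto simp: primitive_idempotents_def)
  then show thesis by (rule that)
qed

section \<open>Spectral calculus: products, valencies and eigenvalues read off from the
  coefficients\<close>

context scheme_spectrum
begin

lemma idempotent_combination_mult_right:
  assumes "j \<le> d"
  shows "(\<Sum>i\<le>d. matrix_scale (a i) (E i)) ** E j = matrix_scale (a j) (E j)"
proof -
  have "(\<Sum>i\<le>d. matrix_scale (a i) (E i)) ** E j = (\<Sum>i\<le>d. if i = j then matrix_scale (a j) (E j) else 0)"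
    unfolding sum_matrix_mult matrix_scale_matrix_mult
    by (intro sum.cong) (auto simp: E_mult assms vec_eq_iff)
  then show ?thesis using assms by simp
qed

lemma idempotent_combination_mult:
  "(\<Sum>i\<le>d. matrix_scale (a i) (E i)) ** (\<Sum>i\<le>d. matrix_scale (b i) (E i)) =
    (\<Sum>i\<le>d. matrix_scale (a i * b i) (E i))"
  unfolding matrix_mult_sum matrix_mult_matrix_scale
  by (intro sum.cong) (auto simp: idempotent_combination_mult_right vec_eq_iff)

lemma idempotent_combination_eq_iff:
  "(\<Sum>i\<le>d. matrix_scale (a i) (E i)) = (\<Sum>i\<le>d. matrix_scale (b i) (E i)) \<longleftrightarrow> (\<forall>i\<le>d. a i = b i)"
proof
  assume eq: "(\<Sum>i\<le>d. matrix_scale (a i) (E i)) = (\<Sum>i\<le>d. matrix_scale (b i) (E i))"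
  show "\<forall>i\<le>d. a i = b i"
  proof (intro allI impI)
    fix i assume i: "i \<le> d"
    obtain x y where "E i $ x $ y \<noteq> 0"
      using E_nonzero[OF i] by (auto simp: vec_eq_iff)
    moreover have "matrix_scale (a i) (E i) = matrix_scale (b i) (E i)"
      using idempotent_combination_mult_right[OF i] eq by metis
    then have "matrix_scale (a i) (E i) $ x $ y = matrix_scale (b i) (E i) $ x $ y"
      by simp
    ultimately show "a i = b i" by simp
  qed
qed simp

lemma adjacency_combination:
  "(\<Sum>j\<le>d. matrix_scale (c j) (adjacency_matrix (R j))) =
    (\<Sum>i\<le>d. matrix_scale (\<Sum>j\<le>d. c j * of_real (P i j)) (E i))"
proof -
  have "(\<Sum>j\<le>d. matrix_scale (c j) (adjacency_matrix (R j))) $ x $ y =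
      (\<Sum>i\<le>d. matrix_scale (\<Sum>j\<le>d. c j * of_real (P i j)) (E i)) $ x $ y" for x y
  proof -
    have "(\<Sum>j\<le>d. matrix_scale (c j) (adjacency_matrix (R j))) $ x $ y =
        (\<Sum>j\<le>d. c j * adjacency_matrix (R j) $ x $ y)"
      by (simp del: adjacency_matrix_nth)
    also have "\<dots> = (\<Sum>j\<le>d. \<Sum>i\<le>d. c j * of_real (P i j) * E i $ x $ y)"
      by (intro sum.cong refl)
        (simp add: adjacency_expansion sum_distrib_left mult.assoc del: adjacency_matrix_nth)
    also have "\<dots> = (\<Sum>i\<le>d. \<Sum>j\<le>d. c j * of_real (P i j) * E i $ x $ y)"
      by (rule sum.swap)
    finally show ?thesis by (simp add: sum_distrib_right)
  qed
  then show ?thesis by (simp only: vec_eq_iff) blast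
qed

lemma adjacency_mult_idempotent:
  assumes "i \<le> d" "j \<le> d"
  shows "adjacency_matrix (R j) ** E i = matrix_scale (of_real (P i j)) (E i)"
  using idempotent_combination_mult_right[OF assms(1)] adjacency_expansion[OF assms(2)] by simp

lemma adjacency_matrix_0: "adjacency_matrix (R 0) = mat 1"
  using symmetric_association_schemeD(1)[OF scheme] by (auto simp: vec_eq_iff mat_def)

lemma eigenmatrix_column_0:
  assumes "i \<le> d"
  shows "P i 0 = 1"
proof -
  obtain x y where "E i $ x $ y \<noteq> 0"
    using E_nonzero[OF assms] by (auto simp: vec_eq_iff)
  moreover have "E i = matrix_scale (of_real (P i 0)) (E i)"
    using adjacency_mult_idempotent[OF assms, of 0] by (simp add: adjacency_matrix_0)
  then have "E i $ x $ y = of_real (P i 0) * E i $ x $ y" by (metis matrix_scale_nth)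
  ultimately show ?thesis by (metis mult_cancel_right1 of_real_eq_1_iff)
qed

lemma mat_expansion: "mat c = (\<Sum>i\<le>d. matrix_scale c (E i))"
proof -
  have "mat 1 = (\<Sum>i\<le>d. matrix_scale 1 (E i))"
    using adjacency_expansion[of 0] by (simp add: adjacency_matrix_0 eigenmatrix_column_0)
  then have "matrix_scale c (mat 1) = matrix_scale c (\<Sum>i\<le>d. matrix_scale 1 (E i))" by simp
  moreover have "matrix_scale c (mat 1) = (mat c :: complex^'a^'a)"
    by (simp add: vec_eq_iff mat_def)
  moreover have "matrix_scale c (\<Sum>i\<le>d. matrix_scale 1 (E i)) = (\<Sum>i\<le>d. matrix_scale c (E i))"
    by (simp add: vec_eq_iff sum_distrib_left)
  ultimately show ?thesis by simp
qed

lemma all_ones_expansion: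
  "(\<chi> x y. c) = (\<Sum>i\<le>d. matrix_scale (if i = 0 then c * of_nat CARD('a) else 0) (E i))"
proof -
  have "(\<Sum>i\<le>d. matrix_scale (if i = 0 then c * of_nat CARD('a) else 0) (E i)) =
      (\<Sum>i\<le>d. if i = 0 then matrix_scale (c * of_nat CARD('a)) (E i) else 0)"
    by (intro sum.cong) (auto simp: vec_eq_iff)
  then show ?thesis by (simp add: E_0 vec_eq_iff)
qed

text \<open>A diagonal entry of the eigenvalue equation for the constant matrix \<open>E 0\<close>
  is a row count divided by the number of points.\<close>

lemma valency:
  assumes "j \<le> d"
  shows "real (card {y. (x, y) \<in> R j}) = P 0 j"
proof -
  have "(adjacency_matrix (R j) ** E 0) $ x $ x = matrix_scale (of_real (P 0 j)) (E 0) $ x $ x"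
    using adjacency_mult_idempotent[of 0 j] assms by simp
  then have "of_nat (card {y. (x, y) \<in> R j}) = complex_of_real (P 0 j)"
    by (simp add: matrix_matrix_mult_def E_0 flip: sum_divide_distrib of_bool_def)
  then show ?thesis by (metis of_real_eq_iff of_real_of_nat_eq)
qed

lemma sum_valencies: "(\<Sum>j\<le>d. P 0 j) = real CARD('a)"
proof -
  have "(\<Sum>j\<le>d. matrix_scale 1 (adjacency_matrix (R j))) = (\<chi> x y. 1)"
    unfolding vec_eq_iff
    using scheme_relation_exists[OF scheme] scheme_combination_nth[OF scheme, of _ _ _ "\<lambda>_. 1"]
    by (metis vec_lambda_beta)
  then have "(\<Sum>j\<le>d. complex_of_real (P 0 j)) = of_nat CARD('a)"
    unfolding adjacency_combination all_ones_expansion idempotent_combination_eq_iff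
    by (auto dest: spec[of _ 0])
  then show ?thesis by (metis of_real_eq_iff of_real_of_nat_eq of_real_sum)
qed

text \<open>Each row of \<open>P\<close> is a character of the algebra: the coefficient at
  \<open>E i\<close> is multiplicative, and it is applied here to the expansion of a product of two
  adjacency matrices.\<close>

lemma intersection_numbers:
  assumes "a \<le> d" "b \<le> d" "i \<le> d"
    and p: "\<And>k x y. k \<le> d \<Longrightarrow> (x, y) \<in> R k \<Longrightarrow> card {z. (x, z) \<in> R a \<and> (z, y) \<in> R b} = p k"
  shows "P i a * P i b = (\<Sum>k\<le>d. real (p k) * P i k)"
proof -
  have "(adjacency_matrix (R a) ** adjacency_matrix (R b)) $ x $ y =
      (\<Sum>k\<le>d. matrix_scale (of_nat (p k)) (adjacency_matrix (R k))) $ x $ y" for x y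
  proof -
    obtain k where k: "k \<le> d" "(x, y) \<in> R k" by (rule scheme_relation_exists[OF scheme])
    have "(adjacency_matrix (R a) ** adjacency_matrix (R b)) $ x $ y =
        (\<Sum>z\<in>UNIV. of_bool ((x, z) \<in> R a \<and> (z, y) \<in> R b))"
      by (simp only: matrix_matrix_mult_def vec_lambda_beta adjacency_matrix_nth of_bool_def)
        (intro sum.cong, auto)
    also have "\<dots> = of_nat (p k)" using p[OF k] by simp
    finally show ?thesis by (simp only: scheme_combination_nth[OF scheme k])
  qed
  then have "adjacency_matrix (R a) ** adjacency_matrix (R b) =
      (\<Sum>k\<le>d. matrix_scale (of_nat (p k)) (adjacency_matrix (R k)))"
    by (simp only: vec_eq_iff) blast
  then have "complex_of_real (P i a) * of_real (P i b) = (\<Sum>k\<le>d. of_nat (p k) * of_real (P i k))"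
    unfolding adjacency_combination adjacency_expansion[OF assms(1)] adjacency_expansion[OF assms(2)]
      idempotent_combination_mult idempotent_combination_eq_iff using assms(3) by blast
  then have "complex_of_real (P i a * P i b) = of_real (\<Sum>k\<le>d. real (p k) * P i k)"
    by simp
  then show ?thesis by (simp only: of_real_eq_iff)
qed

text \<open>The idempotents sum to the identity and \<open>E 0\<close> kills a vector of coordinate
  sum 0, so some \<open>E i\<close> with \<open>i\<close> positive does not; applying it to the
  eigenvector equation identifies the eigenvalue. Conversely, a nonzero column of \<open>E i\<close>
  is an eigenvector, with sum 0 because \<open>E 0 ** E i = 0\<close>.\<close>

lemma nontrivial_eigenvalues_relation:
  assumes j: "j \<le> d"
  shows "nontrivial_eigenvalues (R j) = (\<lambda>i. of_real (P i j)) ` {1..d}"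
proof (intro equalityI subsetI)
  fix \<theta> assume "\<theta> \<in> nontrivial_eigenvalues (R j)"
  then obtain v where v: "v \<noteq> 0" "(\<Sum>x\<in>UNIV. v $ x) = 0" "adjacency_matrix (R j) *v v = \<theta> *s v"
    unfolding nontrivial_eigenvalues_def by blast
  have "\<exists>i\<le>d. E i *v v \<noteq> 0"
  proof (rule ccontr)
    assume "\<not> ?thesis"
    then have zero: "\<And>i x. i \<le> d \<Longrightarrow> (\<Sum>y\<in>UNIV. E i $ x $ y * v $ y) = 0"
      by (simp add: matrix_vector_mult_def vec_eq_iff)
    have "v $ x = 0" for x
    proof -
      have "v $ x = (mat 1 *v v) $ x" by simp
      also have "\<dots> = (\<Sum>y\<in>UNIV. \<Sum>i\<le>d. E i $ x $ y * v $ y)"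
        unfolding mat_expansion[of 1] by (simp add: matrix_vector_mult_def sum_distrib_right)
      also have "\<dots> = (\<Sum>i\<le>d. \<Sum>y\<in>UNIV. E i $ x $ y * v $ y)" by (rule sum.swap)
      also have "\<dots> = 0" by (simp add: zero)
      finally show ?thesis .
    qed
    then show False using v(1) by (simp add: vec_eq_iff)
  qed
  then obtain i where i: "i \<le> d" "E i *v v \<noteq> 0" by blast
  have "E 0 *v v = 0"
    using v(2) by (simp add: E_0 matrix_vector_mult_def vec_eq_iff flip: sum_divide_distrib)
  then have "i \<noteq> 0" using i(2) by metis
  have "E i *v (adjacency_matrix (R j) *v v) = matrix_scale (of_real (P i j)) (E i) *v v"
    using bose_mesner_commute[OF scheme E_in[OF i(1)] bose_mesner_adjacency_matrix[OF scheme j]]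
    by (simp add: matrix_vector_mul_assoc adjacency_mult_idempotent i(1) j)
  also have "\<dots> = of_real (P i j) *s (E i *v v)"
    by (simp add: matrix_vector_mult_def vec_eq_iff sum_distrib_left mult.assoc)
  finally have "\<theta> *s (E i *v v) = of_real (P i j) *s (E i *v v)"
    unfolding v(3) by (simp add: vec.scale)
  then have "\<theta> = of_real (P i j)" using i(2) by (simp add: vec_eq_iff) blast
  then show "\<theta> \<in> (\<lambda>i. of_real (P i j)) ` {1..d}" using i(1) \<open>i \<noteq> 0\<close> by auto
next
  fix \<theta> assume "\<theta> \<in> (\<lambda>i. complex_of_real (P i j)) ` {1..d}"
  then obtain i where i: "i \<le> d" "i \<noteq> 0" "\<theta> = of_real (P i j)" by auto
  obtain x y where xy: "E i $ x $ y \<noteq> 0"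
    using E_nonzero[OF i(1)] by (auto simp: vec_eq_iff)
  define v where "v = (\<chi> x. E i $ x $ y)"
  have "v \<noteq> 0" using xy by (auto simp: v_def vec_eq_iff)
  moreover have "(\<Sum>x\<in>UNIV. v $ x) = 0"
  proof -
    have "(E 0 ** E i) $ y $ y = 0" using E_mult[of 0 i] i by simp
    then show ?thesis
      by (simp add: v_def E_0 matrix_matrix_mult_def flip: sum_divide_distrib)
  qed
  moreover have "adjacency_matrix (R j) *v v = \<theta> *s v"
  proof -
    have "(adjacency_matrix (R j) ** E i) $ x $ y = matrix_scale \<theta> (E i) $ x $ y" for x
      using adjacency_mult_idempotent[OF i(1) j] i(3) by simp
    then show ?thesis
      by (simp add: v_def matrix_matrix_mult_def matrix_vector_mult_def vec_eq_iff)
  qed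
  ultimately show "\<theta> \<in> nontrivial_eigenvalues (R j)"
    unfolding nontrivial_eigenvalues_def by blast
qed

lemma row_sum_iff:
  "(\<forall>x. (\<Sum>y\<in>UNIV. (\<Sum>i\<le>d. matrix_scale (a i) (E i)) $ x $ y) = c) \<longleftrightarrow> a 0 = c"
proof -
  have "(\<Sum>i\<le>d. matrix_scale (a i) (E i)) ** ((\<chi> x y. 1) :: complex^'a^'a) = (\<chi> x y. c) \<longleftrightarrow> a 0 = c"
    unfolding all_ones_expansion idempotent_combination_mult idempotent_combination_eq_iff
    by (auto dest: spec[of _ 0])
  then show ?thesis by (simp add: matrix_matrix_mult_def vec_eq_iff)
qed

text \<open>The product with the conjugate transpose has coefficients \<open>|\<theta> i|^2\<close>,
  while the required right-hand side has 1 at \<open>E 0\<close> and the number of points plus 1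
  elsewhere. The row sums are \<open>\<theta> 0\<close>, and the value -1 already settles the
  coefficient at \<open>E 0\<close>.\<close>

lemma complex_hadamard_bordered_combination:
  fixes w :: "nat \<Rightarrow> complex"
  assumes w: "\<And>j. j \<le> d \<Longrightarrow> cmod (w j) = 1"
  defines "\<theta> \<equiv> \<lambda>i. \<Sum>j\<le>d. w j * of_real (P i j)"
  shows "complex_hadamard (bordered (\<Sum>j\<le>d. matrix_scale (w j) (adjacency_matrix (R j)))) \<longleftrightarrow>
    \<theta> 0 = -1 \<and> (\<forall>i\<in>{1..d}. (cmod (\<theta> i))\<^sup>2 = real CARD('a) + 1)"
proof -
  define M where "M = (\<Sum>j\<le>d. matrix_scale (w j) (adjacency_matrix (R j)))"
  define M' where "M' = (\<Sum>j\<le>d. matrix_scale (cnj (w j)) (adjacency_matrix (R j)))"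
  have M: "M = (\<Sum>i\<le>d. matrix_scale (\<theta> i) (E i))"
    unfolding M_def \<theta>_def by (rule adjacency_combination)
  have M': "M' = (\<Sum>i\<le>d. matrix_scale (cnj (\<theta> i)) (E i))"
    unfolding M'_def \<theta>_def by (simp add: adjacency_combination)
  have MM': "M ** M' = (\<Sum>i\<le>d. matrix_scale (of_real ((cmod (\<theta> i))\<^sup>2)) (E i))"
    unfolding M M' idempotent_combination_mult by (simp only: complex_norm_square)
  have J: "mat (of_nat CARD('a) + 1) - (\<chi> x y. 1) =
      (\<Sum>i\<le>d. matrix_scale (if i = 0 then 1 else of_nat CARD('a) + 1) (E i))"
    unfolding mat_expansion all_ones_expansion sum_subtractf[symmetric]
    by (intro sum.cong) (auto simp: vec_eq_iff algebra_simps)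
  have "M \<in> bose_mesner d R" unfolding M_def bose_mesner_def by (rule rangeI)
  then have "M $ y $ x = M $ x $ y" for x y
    using bose_mesner_transpose[OF scheme] by (metis transpose_def vec_lambda_beta)
  moreover have "M' $ x $ y = cnj (M $ x $ y)" for x y
    unfolding M_def M'_def
    by (rule scheme_relation_exists[OF scheme, of x y]) (simp only: scheme_combination_nth[OF scheme])
  ultimately have "transpose (\<chi> x y. cnj (M $ x $ y)) = M'"
    by (simp add: transpose_def vec_eq_iff)
  moreover have "cmod (M $ x $ y) = 1" for x y
    unfolding M_def
    by (rule scheme_relation_exists[OF scheme, of x y]) (simp only: scheme_combination_nth[OF scheme] w)
  ultimately have "complex_hadamard (bordered M) \<longleftrightarrow>
      (\<forall>x. (\<Sum>y\<in>UNIV. M $ x $ y) = -1) \<and> M ** M' = mat (of_nat CARD('a) + 1) - (\<chi> x y. 1)"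
    by (simp only: complex_hadamard_bordered_iff) simp
  also have "\<dots> \<longleftrightarrow> \<theta> 0 = -1 \<and> M ** M' = mat (of_nat CARD('a) + 1) - (\<chi> x y. 1)"
    unfolding M row_sum_iff ..
  also have "\<dots> \<longleftrightarrow> \<theta> 0 = -1 \<and> (\<Sum>i\<le>d. matrix_scale (of_real ((cmod (\<theta> i))\<^sup>2)) (E i)) =
        (\<Sum>i\<le>d. matrix_scale (if i = 0 then 1 else of_nat CARD('a) + 1) (E i))"
    unfolding MM' J ..
  also have "\<dots> \<longleftrightarrow> \<theta> 0 = -1 \<and> (\<forall>i\<in>{1..d}. (cmod (\<theta> i))\<^sup>2 = real CARD('a) + 1)"
  proof -
    have "complex_of_real t = of_nat CARD('a) + 1 \<longleftrightarrow> t = real CARD('a) + 1" for t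
      by (metis of_real_1 of_real_add of_real_eq_iff of_real_of_nat_eq)
    then show ?thesis
      unfolding idempotent_combination_eq_iff by (auto simp del: of_real_power simp: Suc_le_eq)
  qed
  finally show ?thesis unfolding M_def .
qed

end

section \<open>The handshake lemma and the integer parameters of a two-class scheme\<close>

lemma even_card_sym_irrefl:
  fixes G :: "('a::finite) rel"
  assumes "sym G" "irrefl G"
  shows "even (card G)"
proof -
  obtain f :: "'a \<Rightarrow> nat" where f: "inj f"
    using finite_imp_inj_to_nat_seg[of "UNIV :: 'a set"] by auto
  \<comment> \<open>An injection into the naturals orients every edge, so \<open>G\<close> is the
    disjoint union of \<open>L\<close> and its converse.\<close>
  define L where "L = {(x, y) \<in> G. f x < f y}"
  have "G = L \<union> L\<inverse>"
  proof (intro equalityI subrelI)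
    fix x y assume "(x, y) \<in> G"
    moreover from this have "x \<noteq> y" using assms(2) by (auto simp: irrefl_def)
    then have "f x \<noteq> f y" using f by (simp add: inj_eq)
    ultimately show "(x, y) \<in> L \<union> L\<inverse>"
      using assms(1) by (auto simp: L_def dest: symD)
  qed (use assms(1) in \<open>auto simp: L_def dest: symD\<close>)
  moreover have "L \<inter> L\<inverse> = {}" by (auto simp: L_def)
  ultimately have "card G = card L + card (L\<inverse>)" by (metis card_Un_disjoint finite)
  then show ?thesis by simp
qed

text \<open>The square of the adjacency matrix of \<open>R 1\<close> is a combination of the three
  adjacency matrices with coefficients \<open>k1\<close>, \<open>l\<close>, \<open>m\<close>. Hence
  the two distinct nontrivial eigenvalues are the roots of one monic quadratic, which gives their
  sum and product; row 0 of \<open>P\<close> gives the count of paths of length two. The parity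
  concerns the number of ordered adjacent pairs.\<close>

lemma (in scheme_spectrum) two_class_parameters:
  assumes d: "d = 2" and "P 1 2 = - (P 1 1 + 1)" "P 2 2 = - (P 2 1 + 1)" "P 1 1 \<noteq> P 2 1"
  obtains k1 k2 l m :: nat where "strongly_regular (R 1) k1 l m"
    "P 0 1 = k1" "P 0 2 = k2" "k1 > 0" "k2 > 0" "CARD('a) = 1 + k1 + k2"
    "P 1 1 + P 2 1 = real l - real m" "P 1 1 * P 2 1 = real m - real k1"
    "k1 * k1 = k1 + l * k1 + m * k2" "even ((1 + k1 + k2) * k1)"
proof -
  note schD = symmetric_association_schemeD[OF scheme]
  have atMost_d: "{..d} = {0, 1, 2}" using d by auto
  define x0 :: 'a where "x0 = undefined"
  define k where "k j = card {y. (x0, y) \<in> R j}" for j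
  have val: "card {y. (x, y) \<in> R j} = k j" if "j \<le> d" for x j
    using valency[OF that, of x] valency[OF that, of x0] unfolding k_def by simp
  have P0: "P 0 j = k j" if "j \<le> d" for j using valency[OF that, of x0] unfolding k_def by simp
  have kpos: "k j > 0" if j: "j \<le> d" for j
  proof -
    obtain x y where "(x, y) \<in> R j" using schD(2)[OF j] by auto
    then have "card {y. (x, y) \<in> R j} > 0" by (auto simp: card_gt_0_iff)
    then show ?thesis using val[OF j] by simp
  qed
  have "k 0 = 1" using P0[of 0] eigenmatrix_column_0[of 0] by simp
  then have "real CARD('a) = real (1 + k 1 + k 2)"
    using sum_valencies P0 d unfolding atMost_d by simp
  then have n: "CARD('a) = 1 + k 1 + k 2" by (simp only: of_nat_eq_iff)
  have "\<forall>j\<in>{..d}. \<exists>p. \<forall>(x, y)\<in>R j. card {z. (x, z) \<in> R 1 \<and> (z, y) \<in> R 1} = p"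
    using schD(6)[of 1 1] d by simp
  then obtain p where p: "\<And>j x y. j \<le> d \<Longrightarrow> (x, y) \<in> R j \<Longrightarrow>
      card {z. (x, z) \<in> R 1 \<and> (z, y) \<in> R 1} = p j"
    unfolding bchoice_iff by (auto simp: Ball_def)
  have sym: "sym (R 1)" using schD(5) d by simp
  have "{z. (x0, z) \<in> R 1 \<and> (z, x0) \<in> R 1} = {z. (x0, z) \<in> R 1}"
    using sym by (auto dest: symD)
  then have p0: "p 0 = k 1" using p[of 0 x0 x0] schD(1) by (simp add: k_def)
  have int: "P i 1 * P i 1 = k 1 + p 1 * P i 1 + p 2 * P i 2" if "i \<le> d" for i
    using intersection_numbers[of 1 1 i p] p d that eigenmatrix_column_0[OF that]
    unfolding atMost_d by (simp add: p0)
  have "real (k 1 * k 1) = real (k 1 + p 1 * k 1 + p 2 * k 2)"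
    using int[of 0] P0 d by simp
  then have kk: "k 1 * k 1 = k 1 + p 1 * k 1 + p 2 * k 2" by (simp only: of_nat_eq_iff)
  have e: "P 1 1 * P 1 1 = k 1 + p 1 * P 1 1 + p 2 * (- (P 1 1 + 1))"
    "P 2 1 * P 2 1 = k 1 + p 1 * P 2 1 + p 2 * (- (P 2 1 + 1))"
    unfolding assms(2,3)[symmetric] using int[of 1] int[of 2] d by auto
  \<comment> \<open>The difference of the two quadratic equations, with the difference of the roots
    factored out.\<close>
  then have "(P 1 1 - P 2 1) * (P 1 1 + P 2 1 - (real (p 1) - real (p 2))) = 0" by algebra
  then have sum: "P 1 1 + P 2 1 = real (p 1) - real (p 2)" using assms(4) by simp
  then have prod: "P 1 1 * P 2 1 = real (p 2) - real (k 1)" using e(1) by algebra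
  have disj: "R 0 \<inter> R 1 = {}" "R 2 \<inter> R 1 = {}" "R 2 \<inter> R 0 = {}" and ne: "R 1 \<noteq> {}" "R 2 \<noteq> {}"
    using schD(2,3) d by simp_all
  have irrefl: "irrefl (R 1)" using disj(1) schD(1) by (auto simp: irrefl_def)
  have R2: "(x, y) \<in> R 2" if "x \<noteq> y" "(x, y) \<notin> R 1" for x y
    using scheme_relation_exists[OF scheme, of x y] that schD(1) unfolding d by (auto simp: le_Suc_eq numeral_2_eq_2)
  have srg: "strongly_regular (R 1) (k 1) (p 1) (p 2)"
    unfolding strongly_regular_def using sym irrefl ne disj schD(1) val p R2 d by auto
  have "card (R 1) = card (SIGMA x:UNIV. {y. (x, y) \<in> R 1})"
    by (rule arg_cong[of _ _ card]) auto
  also have "\<dots> = (1 + k 1 + k 2) * k 1" using val d n by simp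
  finally have even: "even ((1 + k 1 + k 2) * k 1)"
    using even_card_sym_irrefl[OF sym irrefl] by simp
  show thesis
    by (rule that[OF srg _ _ _ _ n sum prod kk even]) (use P0 kpos d in simp_all)
qed

section \<open>Unit complex numbers and feasible parameters\<close>

lemma cmod_sq_combination:
  fixes u v w :: complex and x y z :: real
  assumes "cmod u = 1" "cmod v = 1" "cmod w = 1"
  shows "(cmod (x * u + y * v + z * w))\<^sup>2 =
    x\<^sup>2 + y\<^sup>2 + z\<^sup>2 + 2 * x * y * Re (u * cnj v) + 2 * x * z * Re (u * cnj w) + 2 * y * z * Re (v * cnj w)"
proof -
  have "(Re u)\<^sup>2 + (Im u)\<^sup>2 = 1" "(Re v)\<^sup>2 + (Im v)\<^sup>2 = 1" "(Re w)\<^sup>2 + (Im w)\<^sup>2 = 1"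
    using assms cmod_power2 by (metis one_power2)+
  then show ?thesis
    unfolding cmod_power2 by simp algebra
qed

text \<open>Three vectors in the real plane are linearly dependent, so their Gram determinant
  vanishes.\<close>

lemma gram_determinant_unit_complex:
  fixes u v w :: complex
  assumes "cmod u = 1" "cmod v = 1" "cmod w = 1"
  defines "a \<equiv> Re (u * cnj v)" and "b \<equiv> Re (u * cnj w)" and "c \<equiv> Re (v * cnj w)"
  shows "1 + 2 * a * b * c - a\<^sup>2 - b\<^sup>2 - c\<^sup>2 = 0"
proof -
  have "(Re u)\<^sup>2 + (Im u)\<^sup>2 = 1" "(Re v)\<^sup>2 + (Im v)\<^sup>2 = 1" "(Re w)\<^sup>2 + (Im w)\<^sup>2 = 1"
    using assms(1-3) cmod_power2 by (metis one_power2)+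
  then show ?thesis
    unfolding a_def b_def c_def by simp algebra
qed

lemma unit_complex_inner_bounds:
  assumes "cmod u = 1" "cmod v = 1"
  shows "\<bar>Re (u * cnj v)\<bar> \<le> 1"
  using abs_Re_le_cmod[of "u * cnj v"] assms by (simp add: norm_mult)

text \<open>The squared distance of \<open>u\<close> and \<open>v\<close> is
  \<open>2 - 2 * Re (u * cnj v)\<close>.\<close>

lemma unit_complex_inner_eq_1:
  assumes "cmod u = 1" "cmod v = 1"
  shows "Re (u * cnj v) = 1 \<longleftrightarrow> u = v"
proof -
  have 1: "(Re u)\<^sup>2 + (Im u)\<^sup>2 = 1" "(Re v)\<^sup>2 + (Im v)\<^sup>2 = 1"
    using assms cmod_power2 by (metis one_power2)+
  then have "(Re u - Re v)\<^sup>2 + (Im u - Im v)\<^sup>2 = 2 - 2 * Re (u * cnj v)"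
    by simp algebra
  then have "Re (u * cnj v) = 1 \<longleftrightarrow> (Re u - Re v)\<^sup>2 + (Im u - Im v)\<^sup>2 = 0"
    by linarith
  then show ?thesis
    by (simp add: complex_eq_iff sum_power2_eq_zero_iff)
qed

lemma unit_complex_inner_eq_minus_1:
  assumes "cmod u = 1" "cmod v = 1"
  shows "Re (u * cnj v) = -1 \<longleftrightarrow> u = - v"
  using unit_complex_inner_eq_1[of u "- v"] assms by simp linarith

text \<open>Expanded, both norm equations say that \<open>r\<close> and \<open>s\<close> are roots
  of \<open>g t^2 + (a - b + g) t - b - (k1 + k2) / 2\<close>. The conclusions are Vieta's formulas
  for this quadratic, cleared of denominators.\<close>

lemma inner_products:
  fixes w0 w1 w2 :: complex and k1 k2 r s :: real
  assumes w: "cmod w0 = 1" "cmod w1 = 1" "cmod w2 = 1"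
    and rs: "r \<noteq> s"
    and hr: "(cmod (w0 + r * w1 - (r + 1) * w2))\<^sup>2 = k1 + k2 + 2"
    and hs: "(cmod (w0 + s * w1 - (s + 1) * w2))\<^sup>2 = k1 + k2 + 2"
  defines "a \<equiv> Re (w0 * cnj w1)" and "b \<equiv> Re (w0 * cnj w2)" and "g \<equiv> 1 - Re (w1 * cnj w2)"
  shows "b = a + g * (r + s + 1)" "2 * g * (- (r * s)) = k1 + k2 + 2 * b"
proof -
  have *: "1 + t\<^sup>2 + (t + 1)\<^sup>2 + 2 * t * a - 2 * (t + 1) * b - 2 * t * (t + 1) * (1 - g) = k1 + k2 + 2"
    if "(cmod (w0 + t * w1 - (t + 1) * w2))\<^sup>2 = k1 + k2 + 2" for t :: real
    using that cmod_sq_combination[OF w, of 1 t "- (t + 1)"]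
    by (simp add: a_def b_def g_def algebra_simps power2_eq_square)
  have e: "(r - s) * (g * (r + s + 1) + a - b) = 0"
    using *[OF hr] *[OF hs] by algebra
  then show 1: "b = a + g * (r + s + 1)"
    using rs by simp
  have "a = b - g * (r + s + 1)" using 1 by simp
  then show "2 * g * (- (r * s)) = k1 + k2 + 2 * b"
    using *[OF hr] by algebra
qed

text \<open>This serves the case \<open>r + s = -1\<close>, where \<open>a\<close> is a real root.
  For \<open>|k1 - k2|\<close> at least 2 the discriminant is negative; a difference of 1 passes the
  bound and is excluded by the integrality of \<open>q\<close>.\<close>

lemma valencies_eq_of_quadratic:
  fixes k1 k2 q :: int and a :: real
  assumes k: "k1 > 0" "k2 > 0" and q: "(k1 + k2) * q = k1 * k2"
    and a: "2 * q * a\<^sup>2 + a + (k1 + k2) / 2 - 2 * q = 0"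
  shows "k1 = k2"
proof (rule ccontr)
  assume "k1 \<noteq> k2"
  define N e where "N = k1 + k2" and "e = \<bar>k1 - k2\<bar>"
  \<comment> \<open>\<open>N - e\<close> is twice the smaller valency.\<close>
  have e: "e \<ge> 1" "N \<ge> e + 2" using \<open>k1 \<noteq> k2\<close> k by (auto simp: N_def e_def)
  have e2: "e\<^sup>2 = (k1 - k2)\<^sup>2" by (simp add: e_def)
  then have 4: "4 * (N * q) = N\<^sup>2 - e\<^sup>2" using q unfolding N_def by algebra
  \<comment> \<open>The discriminant of \<open>a\<close> must be nonnegative; with \<open>4 N q = N\<^sup>2 - e\<^sup>2\<close> this forces \<open>e \<le> 1\<close>.\<close>
  have "(4 * q * a + 1)\<^sup>2 = 1 - 4 * q * N + 16 * (real_of_int q)\<^sup>2"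
    using a unfolding N_def by simp algebra
  then have "0 \<le> 1 - 4 * q * N + 16 * (real_of_int q)\<^sup>2" by (metis zero_le_power2)
  then have "0 \<le> real_of_int (1 - 4 * q * N + 16 * q\<^sup>2)" by simp
  then have "0 \<le> 1 - 4 * q * N + 16 * q\<^sup>2" by (simp only: of_int_0_le_iff)
  then have "0 \<le> N\<^sup>2 * (1 - 4 * q * N + 16 * q\<^sup>2)" by simp
  also have "\<dots> = N\<^sup>2 - (N\<^sup>2 - e\<^sup>2) * e\<^sup>2" using 4 by algebra
  finally have bound: "N\<^sup>2 * (e\<^sup>2 - 1) \<le> (e\<^sup>2)\<^sup>2" by (simp add: algebra_simps power2_eq_square)
  show False
  proof (cases "e = 1")
    case True
    then have "1 = N * (N - 4 * q)" using 4 by (simp add: algebra_simps power2_eq_square)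
    then have "N dvd 1" by (rule dvdI)
    then show False using e by auto
  next
    case False
    then have e': "e \<ge> 2" using e by simp
    have "(e + 2)\<^sup>2 \<le> N\<^sup>2" using e by (intro power_mono) auto
    moreover have "e\<^sup>2 - 1 \<ge> 0" using e by (simp add: one_le_power)
    ultimately have "(e + 2)\<^sup>2 * (e\<^sup>2 - 1) \<le> (e\<^sup>2)\<^sup>2"
      using bound mult_right_mono order_trans by blast
    \<comment> \<open>The bracket is the excess over \<open>e^4\<close>; it is positive because
      \<open>3 * e^2 > 4\<close> for \<open>e \<ge> 2\<close>.\<close>
    moreover have "(e + 2)\<^sup>2 * (e\<^sup>2 - 1) = (e\<^sup>2)\<^sup>2 + (4 * e * (e\<^sup>2 - 1) + 3 * e\<^sup>2 - 4)" by algebra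
    moreover have "e\<^sup>2 \<ge> 2\<^sup>2" using e' by (intro power_mono) auto
    moreover have "4 * e * (e\<^sup>2 - 1) \<ge> 0" using e \<open>e\<^sup>2 - 1 \<ge> 0\<close> by simp
    ultimately show False by simp
  qed
qed

text \<open>The left-hand side of the last hypothesis is the value of \<open>a\<close> after
  \<open>b\<close> is eliminated. Taking \<open>g = 2\<close> there bounds \<open>q\<close> from
  below, and the arithmetic-geometric mean inequality for \<open>k1\<close> and
  \<open>k2 + d\<close> bounds it from above; together they give
  \<open>2 N (d - 1) \<le> d^2\<close>, and \<open>N \<ge> d + 1\<close> leaves
  \<open>d = 1\<close>.\<close>

lemma parameters_of_positive_defect:
  fixes k1 k2 q d :: int and g :: real
  assumes k: "k1 > 0" "k2 > 0" and q: "(k1 + k2) * q = k1 * (k2 + d)"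
    and d: "d \<ge> 1" "d \<le> k1" and g: "0 \<le> g" "g \<le> 2"
    and a: "g * (q - d) - (k1 + k2) / 2 \<ge> -1"
  shows "d = 1" "4 * q = k1 + k2 + 2" "k1 = k2 \<or> k1 = k2 + 2"
proof -
  define N where "N = k1 + k2"
  have N: "N \<ge> d + 1" using k d by (simp add: N_def)
  have "N * q > 0" using q k d by (simp add: N_def)
  then have "q > 0" using N d by (simp add: zero_less_mult_iff)
  \<comment> \<open>This sign is what allows \<open>g\<close> to be replaced by its upper bound 2.
    Otherwise \<open>N \<le> 2\<close>, whereas \<open>0 < q < d < N\<close> makes \<open>N\<close>
    at least 3.\<close>
  have "q \<ge> d"
  proof (rule ccontr)
    assume "\<not> q \<ge> d"
    then have "g * (q - d) \<le> 0" using g by (intro mult_nonneg_nonpos) auto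
    then have "real_of_int N \<le> 2" using a unfolding N_def by argo
    then have "N \<le> 2" by simp
    then show False using N d \<open>q > 0\<close> \<open>\<not> q \<ge> d\<close> by simp
  qed
  then have "g * real_of_int (q - d) \<le> 2 * real_of_int (q - d)" using g by (intro mult_right_mono) auto
  then have "4 * real_of_int (q - d) \<ge> real_of_int N - 2" using a unfolding N_def by argo
  then have "real_of_int (4 * (q - d)) \<ge> real_of_int (N - 2)" by simp
  then have "N - 2 \<le> 4 * (q - d)" by (simp only: of_int_le_iff)
  then have q_lower: "4 * q \<ge> N - 2 + 4 * d" by presburger
  \<comment> \<open>The arithmetic-geometric mean inequality as an identity; the square subtracted
    later determines \<open>k1 - k2\<close>.\<close>
  have sq: "4 * (N * q) = (N + d)\<^sup>2 - (k1 - k2 - d)\<^sup>2" using q unfolding N_def by algebra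
  have "N * (N - 2 + 4 * d) \<le> N * (4 * q)" using q_lower N d by (intro mult_left_mono) auto
  also have "\<dots> = 4 * (N * q)" by simp
  also have "\<dots> \<le> (N + d)\<^sup>2" unfolding sq by simp
  finally have "2 * (N * (d - 1)) \<le> d\<^sup>2" by (simp add: algebra_simps power2_eq_square)
  moreover have "(d + 1) * (d - 1) \<le> N * (d - 1)" using N d by (intro mult_right_mono) auto
  ultimately have "d\<^sup>2 \<le> 2" by (simp add: algebra_simps power2_eq_square)
  moreover have "2\<^sup>2 \<le> d\<^sup>2" if "d \<ge> 2" using that by (intro power_mono) auto
  ultimately show d1: "d = 1" using d by force
  have "4 * q < N + 3"
  proof (rule ccontr)
    assume "\<not> 4 * q < N + 3"
    then have "N * (N + 3) \<le> N * (4 * q)" using N d by (intro mult_left_mono) auto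
    also have "\<dots> = 4 * (N * q)" by simp
    also have "\<dots> \<le> (N + 1)\<^sup>2" unfolding sq d1 by simp
    finally show False using N d1 by (simp add: algebra_simps power2_eq_square)
  qed
  then have q4: "4 * q = N + 2" using q_lower d1 by simp
  then show "4 * q = k1 + k2 + 2" by (simp add: N_def)
  have "(k1 - k2 - 1)\<^sup>2 = 1" using sq q4 d1 by algebra
  then have "k1 - k2 - 1 = 1 \<or> k1 - k2 - 1 = -1" by (simp add: power2_eq_1_iff)
  then show "k1 = k2 \<or> k1 = k2 + 2" by auto
qed

section \<open>From the Hadamard equations to the parameters and the weights\<close>

lemma unit_complex_with_Re:
  fixes w :: complex and K :: real
  assumes "cmod w = 1" "K > 0" "Re w = - 1 / K"
  shows "w = (-1 + \<i> * sqrt (K\<^sup>2 - 1)) / K \<or> w = (-1 - \<i> * sqrt (K\<^sup>2 - 1)) / K"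
proof -
  have "(Re w)\<^sup>2 + (Im w)\<^sup>2 = 1" using assms(1) cmod_power2 by (metis one_power2)
  then have "(K * Im w)\<^sup>2 = K\<^sup>2 - 1"
    using assms(2,3) by (simp add: field_simps)
  then have "K * Im w = sqrt (K\<^sup>2 - 1) \<or> K * Im w = - sqrt (K\<^sup>2 - 1)"
    by (metis abs_real_def minus_minus real_sqrt_abs)
  then show ?thesis using assms(2,3)
    by (auto simp: complex_eq_iff Re_divide_of_real Im_divide_of_real field_simps)
qed

lemma bordered_hadamard_parameters:
  fixes k1 k2 l m :: nat and r s :: real and w0 w1 w2 :: complex
  assumes k: "k1 > 0" "k2 > 0"
    and par: "r + s = real l - real m" "r * s = real m - real k1" "k1 * k1 = k1 + l * k1 + m * k2"
    and handshake: "even ((1 + k1 + k2) * k1)"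
    and rs: "r \<ge> 0" "s \<le> -1" "r + s \<ge> -1"
    and w: "cmod w0 = 1" "cmod w1 = 1" "cmod w2 = 1" "w1 \<noteq> w2"
    and h0: "w0 + k1 * w1 + k2 * w2 = -1"
    and hr: "(cmod (w0 + r * w1 - (r + 1) * w2))\<^sup>2 = real k1 + real k2 + 2"
    and hs: "(cmod (w0 + s * w1 - (s + 1) * w2))\<^sup>2 = real k1 + real k2 + 2"
  defines "K \<equiv> 2 * r * (r + 1)"
  shows "r + s = -1 \<and> k1 = k2 \<and> real k1 = K \<and>
      ((w0, w1, w2) = (-1, \<i>, -\<i>) \<or> (w0, w1, w2) = (-1, -\<i>, \<i>) \<or>
       (w0, w1, w2) = (1, (-1 + \<i> * sqrt (K\<^sup>2 - 1)) / K, (-1 - \<i> * sqrt (K\<^sup>2 - 1)) / K) \<or>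
       (w0, w1, w2) = (1, (-1 - \<i> * sqrt (K\<^sup>2 - 1)) / K, (-1 + \<i> * sqrt (K\<^sup>2 - 1)) / K)) \<or>
    real k1 = 2 * r\<^sup>2 \<and> s = - r \<and> (w0, w1, w2) = (1, -1, 1)"
proof -
  define a b c g where "a = Re (w0 * cnj w1)" and "b = Re (w0 * cnj w2)"
    and "c = Re (w1 * cnj w2)" and "g = 1 - c"
  \<comment> \<open>Through \<open>l\<close> and \<open>m\<close> the quantities
    \<open>r + s + 1\<close> and \<open>-rs\<close> are integers, which the arithmetic lemmas rely
    on.\<close>
  define d q where "d = int l - int m + 1" and "q = int k1 - int m"
  have d: "r + s + 1 = d" and q: "- (r * s) = q"
    using par by (simp_all add: d_def q_def)
  have "int (k1 * k1) = int (k1 + l * k1 + m * k2)" using par(3) by simp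
  then have kq: "(int k1 + int k2) * q = int k1 * (int k2 + d)"
    unfolding d_def q_def by simp algebra
  have bounds: "\<bar>a\<bar> \<le> 1" "\<bar>b\<bar> \<le> 1" "\<bar>c\<bar> \<le> 1"
    unfolding a_def b_def c_def by (intro unit_complex_inner_bounds w)+
  have "c \<noteq> 1" unfolding c_def using unit_complex_inner_eq_1[OF w(2,3)] w(4) by simp
  then have g: "0 < g" "g \<le> 2" using bounds by (auto simp: g_def)
  have "r \<noteq> s" using rs by simp
  from inner_products[OF w(1-3) this hr hs]
  have bg: "b = a + g * d" and gq: "2 * g * q = real k1 + real k2 + 2 * b"
    unfolding d q by (simp_all add: a_def b_def c_def g_def)
  have gram: "1 + 2 * a * b * c - a\<^sup>2 - b\<^sup>2 - c\<^sup>2 = 0"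
    unfolding a_def b_def c_def by (rule gram_determinant_unit_complex[OF w(1-3)])
  have "d \<ge> 0" using d rs by linarith
  then consider "d = 0" | "d \<ge> 1" by linarith
  then show ?thesis
  proof cases
    case 1
    then have ab: "b = a" using bg by simp
    \<comment> \<open>For \<open>b = a\<close> the Gram determinant factors as
      \<open>(1 - c) * (1 + c - 2 * a^2)\<close>.\<close>
    have "g * (2 - g - 2 * a\<^sup>2) = 0" using gram unfolding ab g_def by algebra
    then have g_eq: "g = 2 - 2 * a\<^sup>2" using g by simp
    have quad: "2 * q * a\<^sup>2 + a + (int k1 + int k2) / 2 - 2 * q = 0"
      using gq unfolding ab g_eq by (simp add: field_simps)
    have "int k1 = int k2"
      using valencies_eq_of_quadratic[OF _ _ _ quad] k kq 1 by simp
    then have kk: "k1 = k2" by simp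
    have "2 * q = int k1"
    proof -
      have "int k1 * (2 * q) = int k1 * int k1" using kq 1 unfolding kk by (simp add: algebra_simps)
      then show ?thesis using k by simp
    qed
    then have kq2: "real k1 = 2 * q" by (metis of_int_mult of_int_numeral of_int_of_nat_eq)
    have s: "s = -1 - r" using d 1 by simp
    then have K: "real k1 = K" using q unfolding kq2 K_def of_int_mult of_int_numeral by algebra
    have Kpos: "K > 0" using K k by simp
    \<comment> \<open>With equal valencies \<open>k1 = 2 * q\<close>, so the constant term of the
      quadratic cancels.\<close>
    have "2 * q * a\<^sup>2 + a = 0" using quad kq2 unfolding kk by simp
    moreover have "K = 2 * real_of_int q" using K kq2 by simp
    ultimately have "a * (K * a + 1) = 0" by (simp add: power2_eq_square algebra_simps)
    then have "a = 0 \<or> K * a = -1" unfolding mult_eq_0_iff by linarith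
    then consider "a = 0" | "a = - 1 / K" using Kpos by (auto simp: field_simps)
    then show ?thesis
    proof cases
      case 1
      then have "c = -1" using g_eq by (simp add: g_def)
      then have w12: "w2 = - w1" using unit_complex_inner_eq_minus_1[OF w(2,3)] by (simp add: c_def)
      then have w0: "w0 = -1" using h0 kk by simp
      then have "Re w1 = 0" using 1 by (simp add: a_def)
      moreover from this have "(Im w1)\<^sup>2 = 1" using w(2) cmod_power2[of w1] by simp
      ultimately have "w1 = \<i> \<or> w1 = - \<i>" by (auto simp: complex_eq_iff power2_eq_1_iff)
      then show ?thesis using s kk K w0 w12 by auto
    next
      case 2
      \<comment> \<open>As \<open>a = b\<close> and \<open>c = 2 * a^2 - 1\<close>,
        \<open>w2\<close> is the reflection of \<open>w1\<close> in the line through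
        \<open>w0\<close>; hence \<open>w1 + w2\<close> is twice the projection of \<open>w1\<close>
        onto that line.\<close>
      have "(cmod (of_real (- 2 * a) * w0 + of_real 1 * w1 + of_real 1 * w2))\<^sup>2 = 0"
        unfolding cmod_sq_combination[OF w(1-3)] a_def[symmetric] b_def[symmetric] c_def[symmetric]
        using g_eq ab by (simp add: g_def power2_eq_square)
      then have w12: "w1 + w2 = of_real (2 * a) * w0" by (simp add: algebra_simps add_eq_0_iff)
      have "w0 + of_real K * (w1 + w2) = -1" using h0 kk K by (simp add: distrib_left add.assoc flip: K)
      then have "w0 + of_real (K * (2 * a)) * w0 = -1" unfolding w12 by (simp add: mult.assoc)
      moreover have "K * (2 * a) = -2" using 2 Kpos by simp
      ultimately have w0: "w0 = 1" by simp
      have "Re w1 = - 1 / K" "w2 = of_real (- 2 / K) - w1"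
        using 2 w12 unfolding a_def w0 by (simp_all add: algebra_simps)
      moreover have "of_real (- 2 / K) - (-1 + \<i> * sqrt (K\<^sup>2 - 1)) / K = (-1 - \<i> * sqrt (K\<^sup>2 - 1)) / K"
        "of_real (- 2 / K) - (-1 - \<i> * sqrt (K\<^sup>2 - 1)) / K = (-1 + \<i> * sqrt (K\<^sup>2 - 1)) / K"
        using Kpos by (simp_all add: field_simps)
      ultimately show ?thesis
        using unit_complex_with_Re[OF w(2) Kpos] s kk K w0 by auto
    qed
  next
    case 2
    \<comment> \<open>This shows \<open>r \<le> k1\<close>, since \<open>k1 - s\<close> is positive;
      then \<open>d \<le> r \<le> k1\<close> because \<open>s \<le> -1\<close>.\<close>
    have "(real k1 - r) * (real k1 - s) = real m * (real k1 + real k2 + 1)"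
    proof -
      have "real (k1 * k1) = real (k1 + l * k1 + m * k2)" using par(3) by simp
      then show ?thesis using par(1,2) by simp algebra
    qed
    also have "\<dots> \<ge> 0" by simp
    finally have "real k1 - r \<ge> 0" using rs by (simp add: zero_le_mult_iff)
    then have "d \<le> int k1" using d rs by linarith
    moreover have a_eq: "a = g * (q - d) - (int k1 + int k2) / 2"
      using bg gq by (simp add: field_simps)
    ultimately have d1: "d = 1" and q4: "4 * q = int k1 + int k2 + 2"
      and k12: "int k1 = int k2 \<or> int k1 = int k2 + 2"
      using parameters_of_positive_defect[of "int k1" "int k2" q d g] k kq 2 g bounds by auto
    \<comment> \<open>Equal valencies would make both \<open>k1\<close> and the number of points
      \<open>1 + 2 * k1\<close> odd.\<close>
    have "k1 \<noteq> k2"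
    proof
      assume "k1 = k2"
      then have "int k1 = 2 * q - 1" using q4 by simp
      then have "odd k1" by presburger
      then show False using handshake \<open>k1 = k2\<close> by simp
    qed
    then have kk: "k1 = k2 + 2" using k12 by simp
    then have "2 * q = int k2 + 2" using q4 by simp
    then have "real_of_int (2 * q) = real_of_int (int k2 + 2)" by (rule arg_cong)
    then have rq: "2 * real_of_int q = k2 + 2" by simp
    have s: "s = - r" using d d1 by simp
    then have "real k1 = 2 * r\<^sup>2" using q rq kk by (simp add: power2_eq_square)
    moreover have "real_of_int q = k2 / 2 + 1" using rq by simp
    \<comment> \<open>Since \<open>g \<le> 2\<close> and \<open>a \<ge> -1\<close>, this formula
      forces both to be equalities.\<close>
    then have a': "a = (g - 2) * k2 / 2 - 1"
      unfolding a_eq d1 kk by (simp add: field_simps)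
    then have "(g - 2) * k2 \<ge> 0" using bounds(1) by simp
    then have "g = 2" using g k by (simp add: zero_le_mult_iff)
    then have "c = -1" "a = -1" using a' by (simp_all add: g_def)
    then have w12: "w1 = - w2" "w0 = - w1"
      using unit_complex_inner_eq_minus_1[OF w(2,3)] unit_complex_inner_eq_minus_1[OF w(1,2)]
      unfolding a_def c_def by blast+
    then have "w0 = 1" using h0 unfolding kk w12 by (simp add: algebra_simps)
    then have "(w0, w1, w2) = (1, -1, 1)" using w12 by auto
    ultimately show ?thesis using s by simp
  qed
qed

text \<open>The sum has real part \<open>1 + 1 / K\<close> and imaginary part
  \<open>(2 * t + 1) * S / K\<close>, where \<open>(2 * t + 1)^2 = 2 * K + 1\<close>. It is meant
  for \<open>t\<close> equal to \<open>r\<close> or \<open>s\<close> and for either sign of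
  \<open>S\<close>.\<close>

lemma conference_hadamard_equation:
  fixes t K S :: real
  assumes "2 * t * (t + 1) = K" "K > 0" "S\<^sup>2 = K\<^sup>2 - 1"
  shows "(cmod (1 + t * ((-1 + \<i> * S) / K) - (t + 1) * ((-1 - \<i> * S) / K)))\<^sup>2 = 2 * K + 2"
proof -
  have "1 + t * ((-1 + \<i> * S) / K) - (t + 1) * ((-1 - \<i> * S) / K) = Complex (1 + 1 / K) ((2 * t + 1) * S / K)"
    using assms(2) by (simp add: complex_eq_iff Re_divide_of_real Im_divide_of_real field_simps)
  moreover have "(1 + 1 / K)\<^sup>2 + ((2 * t + 1) * S / K)\<^sup>2 = ((K + 1)\<^sup>2 + (2 * t + 1)\<^sup>2 * S\<^sup>2) / K\<^sup>2"
    using assms(2) by (simp add: field_simps power_divide power_mult_distrib power2_eq_square)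
  moreover have "(2 * t + 1)\<^sup>2 = 2 * K + 1"
    by (simp add: power2_eq_square algebra_simps flip: assms(1))
  then have "(K + 1)\<^sup>2 + (2 * t + 1)\<^sup>2 * S\<^sup>2 = (2 * K + 2) * K\<^sup>2"
    unfolding assms(3) by (simp add: algebra_simps power2_eq_square)
  ultimately show ?thesis using assms(2) by (simp add: cmod_power2)
qed

lemma conference_hadamard_equation_imaginary:
  fixes t K :: real and u :: complex
  assumes "2 * t * (t + 1) = K" "u = \<i> \<or> u = - \<i>"
  shows "(cmod (-1 + t * u - (t + 1) * (- u)))\<^sup>2 = 2 * K + 2"
proof -
  have "-1 + t * u - (t + 1) * (- u) = -1 + of_real (2 * t + 1) * u" by (simp add: algebra_simps)
  moreover have "(cmod (-1 + of_real c * u))\<^sup>2 = 1 + c\<^sup>2" for c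
    using assms(2) unfolding cmod_power2 by auto
  ultimately have "(cmod (-1 + t * u - (t + 1) * (- u)))\<^sup>2 = 1 + (2 * t + 1)\<^sup>2"
    by (simp only:)
  then show ?thesis
    by (simp add: power2_eq_square algebra_simps flip: assms(1))
qed

section \<open>The characterization\<close>

theorem theorem1p1:
  fixes R :: "nat \<Rightarrow> ('a::finite) rel"
    and k1 k2 r s :: real
    and w0 w1 w2 :: complex
  defines "A \<equiv> \<lambda>j. adjacency_matrix (R j)"
  defines "W1 \<equiv> matrix_scale w0 (A 0) + matrix_scale w1 (A 1) + matrix_scale w2 (A 2)"
  defines "W \<equiv> bordered W1"
  assumes "symmetric_association_scheme 2 R"
    and "first_eigenmatrix 2 R
           (\<lambda>i j. complex_of_real
              ([[1, k1, k2],
                [1, r, - (r + 1)],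
                [1, s, - (s + 1)]] ! i ! j))"
    and "r \<ge> 0" and "s \<le> -1" and "r + s \<ge> -1"
    and "cmod w0 = 1" and "cmod w1 = 1" and "cmod w2 = 1" and "w1 \<noteq> w2"
  shows "complex_hadamard W \<longleftrightarrow>
     (conference_graph (R 1) \<and> real CARD('a) = (2 * r + 1)\<^sup>2 \<and>
        ((w0, w1, w2) = (-1, \<i>, -\<i>) \<or>
         (w0, w1, w2) = (-1, -\<i>, \<i>) \<or>
         (w0, w1, w2) =
           (1,
            (-1 + \<i> * complex_of_real (sqrt (4 * r\<^sup>2 * (r + 1)\<^sup>2 - 1)))
              / complex_of_real (2 * r * (r + 1)),
            (-1 - \<i> * complex_of_real (sqrt (4 * r\<^sup>2 * (r + 1)\<^sup>2 - 1)))
              / complex_of_real (2 * r * (r + 1))) \<or>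
         (w0, w1, w2) =
           (1,
            (-1 - \<i> * complex_of_real (sqrt (4 * r\<^sup>2 * (r + 1)\<^sup>2 - 1)))
              / complex_of_real (2 * r * (r + 1)),
            (-1 + \<i> * complex_of_real (sqrt (4 * r\<^sup>2 * (r + 1)\<^sup>2 - 1)))
              / complex_of_real (2 * r * (r + 1))))) \<or>
     ((k1, r, s) = (2 * r\<^sup>2, r, -r) \<and> (w0, w1, w2) = (1, -1, 1))"
proof -
  define P :: "nat \<Rightarrow> nat \<Rightarrow> real"
    where "P i j = [[1, k1, k2], [1, r, - (r + 1)], [1, s, - (s + 1)]] ! i ! j" for i j
  have P: "P 0 0 = 1" "P 0 1 = k1" "P 0 2 = k2" "P 1 0 = 1" "P 1 1 = r" "P 1 2 = - (r + 1)"
    "P 2 0 = 1" "P 2 1 = s" "P 2 2 = - (s + 1)"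
    by (simp_all add: P_def)
  have atMost_2: "{..2::nat} = {0, 1, 2}" by auto
  have rs: "r \<noteq> s" using assms(6,7) by simp
  obtain E where "scheme_spectrum 2 R P E"
    using first_eigenmatrix_spectrum[OF assms(4), of P] assms(5) unfolding P_def by blast
  then interpret scheme_spectrum 2 R P E .
  obtain K1 K2 l m :: nat where srg: "strongly_regular (R 1) K1 l m"
    and K: "k1 = K1" "k2 = K2" "K1 > 0" "K2 > 0" "CARD('a) = 1 + K1 + K2"
    and par: "r + s = real l - real m" "r * s = real m - real K1" "K1 * K1 = K1 + l * K1 + m * K2"
    and handshake: "even ((1 + K1 + K2) * K1)"
    using two_class_parameters[OF refl] rs unfolding P by metis
  have n: "real CARD('a) = 1 + real K1 + real K2" using K(5) by simp
  define w where "w j = [w0, w1, w2] ! j" for j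
  have w: "w 0 = w0" "w 1 = w1" "w 2 = w2" by (simp_all add: w_def)
  have "W = bordered (\<Sum>j\<le>2. matrix_scale (w j) (adjacency_matrix (R j)))"
    unfolding W_def W1_def A_def atMost_2 by (simp add: w add.assoc del: One_nat_def)
  moreover have "cmod (w j) = 1" if "j \<le> 2" for j
  proof -
    have "j \<in> {0, 1, 2}" using that unfolding atMost_2[symmetric] by simp
    then show ?thesis using assms(9-11) w by auto
  qed
  moreover have "{1..2::nat} = {1, 2}" by auto
  \<comment> \<open>The three rows of \<open>P\<close> give one scalar equation each; the number of
    points plus 1 is \<open>K1 + K2 + 2\<close>.\<close>
  ultimately have hadamard: "complex_hadamard W \<longleftrightarrow>
      w0 + K1 * w1 + K2 * w2 = -1 \<and>
      (cmod (w0 + r * w1 - (r + 1) * w2))\<^sup>2 = real K1 + real K2 + 2 \<and>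
      (cmod (w0 + s * w1 - (s + 1) * w2))\<^sup>2 = real K1 + real K2 + 2"
    using complex_hadamard_bordered_combination[of w]
    unfolding atMost_2 by (simp add: w P K n algebra_simps del: One_nat_def)
  have eigenvalues: "nontrivial_eigenvalues (R 1) = {complex_of_real r, complex_of_real s}"
  proof -
    have "nontrivial_eigenvalues (R 1) = (\<lambda>i. complex_of_real (P i 1)) ` {1, 2}"
      using nontrivial_eigenvalues_relation[of 1] \<open>{1..2} = {1, 2}\<close> by (simp del: One_nat_def)
    then show ?thesis by (simp add: P del: One_nat_def)
  qed
  have conference: "conference_graph (R 1) \<longleftrightarrow> r + s = -1 \<and> real K1 = 2 * r * (r + 1)"
  proof
    assume "conference_graph (R 1)"
    then obtain k l' m' and r' s' :: real where *: "strongly_regular (R 1) k l' m'"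
      "nontrivial_eigenvalues (R 1) = {complex_of_real r', complex_of_real s'}"
      "real k = 2 * r' * (r' + 1)" "r' + s' = -1"
      unfolding conference_graph_def by blast
    have "k = K1" using *(1) srg unfolding strongly_regular_def by metis
    \<comment> \<open>Equality of the two-element sets fixes the eigenvalues only up to order;
      \<open>2 * t * (t + 1)\<close> is invariant under \<open>t\<close> going to
      \<open>-1 - t\<close>, so either order yields the same valency condition.\<close>
    moreover have r': "r' = r \<and> s' = s \<or> r' = s \<and> s' = r"
      using *(2) rs unfolding eigenvalues doubleton_eq_iff by auto
    moreover have sum: "r + s = -1" using r' *(4) by auto
    then have "s = -1 - r" by simp
    then have "2 * s * (s + 1) = 2 * r * (r + 1)" by algebra
    ultimately show "r + s = -1 \<and> real K1 = 2 * r * (r + 1)"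
      using *(3) sum by metis
  next
    assume "r + s = -1 \<and> real K1 = 2 * r * (r + 1)"
    then show "conference_graph (R 1)"
      unfolding conference_graph_def using srg eigenvalues by blast
  qed
  have "real (K1 * K1) = real (K1 + l * K1 + m * K2)" using par(3) by simp
  then have kq: "(real K1 + real K2) * (- (r * s)) = real K1 * (real K2 + (r + s + 1))"
    using par(1,2) by simp algebra
  define K where "K = 2 * r * (r + 1)"
  have K_sq: "K\<^sup>2 - 1 = 4 * r\<^sup>2 * (r + 1)\<^sup>2 - 1" by (simp add: K_def power_mult_distrib)
  show ?thesis (is "_ \<longleftrightarrow> ?conference \<or> ?real")
  proof
    assume "complex_hadamard W"
    then consider "r + s = -1 \<and> K1 = K2 \<and> real K1 = K"
        "(w0, w1, w2) = (-1, \<i>, -\<i>) \<or> (w0, w1, w2) = (-1, -\<i>, \<i>) \<or>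
         (w0, w1, w2) = (1, (-1 + \<i> * sqrt (K\<^sup>2 - 1)) / K, (-1 - \<i> * sqrt (K\<^sup>2 - 1)) / K) \<or>
         (w0, w1, w2) = (1, (-1 - \<i> * sqrt (K\<^sup>2 - 1)) / K, (-1 + \<i> * sqrt (K\<^sup>2 - 1)) / K)"
      | "real K1 = 2 * r\<^sup>2" "s = - r" "(w0, w1, w2) = (1, -1, 1)"
      using bordered_hadamard_parameters[OF K(3,4) par handshake assms(6-12)]
      unfolding hadamard K_def by argo
    then show "?conference \<or> ?real"
    proof cases
      case 1
      then have "real CARD('a) = (2 * r + 1)\<^sup>2"
        using n by (simp add: K_def power2_eq_square algebra_simps)
      moreover have "conference_graph (R 1)" using 1(1) unfolding conference K_def by simp
      ultimately show ?thesis using 1(2) unfolding K_sq unfolding K_def by blast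
    next
      case 2
      then show ?thesis by (simp add: K(1))
    qed
  next
    assume "?conference \<or> ?real"
    then show "complex_hadamard W"
    proof
      assume c: ?conference
      then have rs1: "r + s = -1" and K1: "real K1 = K"
        by (simp_all only: conference K_def)
      have s: "s = -1 - r" using rs1 by simp
      have Kpos: "K > 0" using K1 K(3) by simp
      \<comment> \<open>Here \<open>-rs = r * (r + 1)\<close> is half of \<open>K\<close>, so the
        counting identity determines the second valency.\<close>
      have "K * K2 = K * K"
        using kq unfolding K1 s by (simp add: K_def algebra_simps)
      then have K2: "real K2 = K" using Kpos by simp
      have K12: "complex_of_nat K1 = K" "complex_of_nat K2 = K"
        using K1 K2 by (metis of_real_of_nat_eq)+
      have tr: "2 * r * (r + 1) = K" and ts: "2 * s * (s + 1) = K"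
        by (simp_all add: K_def s algebra_simps)
      \<comment> \<open>\<open>K\<close> is a positive integer valency, so the square root is that
        of a nonnegative number.\<close>
      have "K \<ge> 1" using K1 K(3) by simp
      then have "K\<^sup>2 \<ge> 1" by (simp add: one_le_power)
      then have S: "(sqrt (K\<^sup>2 - 1))\<^sup>2 = K\<^sup>2 - 1" "(- sqrt (K\<^sup>2 - 1))\<^sup>2 = K\<^sup>2 - 1" by simp_all
      from c consider "w0 = -1" "w1 = \<i> \<or> w1 = - \<i>" "w2 = - w1"
        | S where "S\<^sup>2 = K\<^sup>2 - 1" "w0 = 1" "w1 = (-1 + \<i> * complex_of_real S) / K"
            "w2 = (-1 - \<i> * complex_of_real S) / K"
        unfolding K_sq[symmetric] K_def[symmetric] using S
        by (smt (verit) Pair_inject minus_minus diff_minus_eq_add mult_minus_right of_real_minus uminus_add_conv_diff add_uminus_conv_diff)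
      then show ?thesis
      proof cases
        case 1
        then show ?thesis
          using conference_hadamard_equation_imaginary[OF tr 1(2)]
            conference_hadamard_equation_imaginary[OF ts 1(2)]
          unfolding hadamard by (simp add: K12 K1 K2)
      next
        case 2
        have "w0 + K * w1 + K * w2 = -1"
          using Kpos unfolding 2 by (simp add: field_simps)
        then show ?thesis
          using conference_hadamard_equation[OF tr Kpos 2(1)]
            conference_hadamard_equation[OF ts Kpos 2(1)]
          unfolding hadamard K12 K1 K2 unfolding 2 by simp
      qed
    next
      assume ?real
      then have K1: "real K1 = 2 * r\<^sup>2" and s: "s = - r" and ws: "w0 = 1" "w1 = -1" "w2 = 1"
        by (simp_all add: K(1))
      \<comment> \<open>Positivity allows \<open>r^2\<close> to be cancelled from the counting
        identity, leaving \<open>K2 = 2 * r^2 - 2\<close>.\<close>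
      have "r\<^sup>2 > 0" using K1 K(3) by (metis of_nat_0_less_iff zero_less_mult_pos zero_less_numeral)
      moreover have "r\<^sup>2 * (2 * r\<^sup>2 + real K2) = r\<^sup>2 * (2 * (real K2 + 1))"
        using kq unfolding K1 s by (simp add: algebra_simps power2_eq_square)
      ultimately have K2: "real K2 = 2 * r\<^sup>2 - 2" by simp
      have "complex_of_nat K1 = of_real (2 * r\<^sup>2)" "complex_of_nat K2 = of_real (2 * r\<^sup>2 - 2)"
        using K1 K2 by (metis of_real_of_nat_eq)+
      then have "w0 + K1 * w1 + K2 * w2 = -1" by (simp add: ws)
      \<comment> \<open>Both nontrivial eigenvalues are of the form \<open>-2 * t\<close> with
        \<open>t = r\<close> or \<open>t = -r\<close>; their squares equal
        \<open>4 * r^2 = K1 + K2 + 2\<close>.\<close>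
      moreover have "w0 + t * w1 - (t + 1) * w2 = of_real (- 2 * t)" for t :: real
        by (simp add: ws)
      then have "(cmod (w0 + t * w1 - (t + 1) * w2))\<^sup>2 = 4 * t\<^sup>2" for t :: real
        by (simp only: norm_of_real power2_abs) (simp add: power_mult_distrib)
      ultimately show ?thesis unfolding hadamard by (simp only: s K1 K2) simp
    qed
  qed
qed

end
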